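(* Let $N=r_1+r_2$ with natural numbers $r_1,r_2$, and let $U\subseteq\mathcal{H}^{(r_1,r_2)}$ be a linear subspace with a basis $\{v_1,\ldots,v_l\}$. Consider the right ideal $\mathcal{R}_U := \sum_{k=1}^l\mathcal{R}_{v_k}$ (a not necessarily direct sum) of $\mathbb{C}[\mathcal{S}_N]$. (i) $U\subseteq\mathcal{H}_{\mathcal{R}_U}$. (ii) Every right ideal $\mathcal{R}\subseteq\mathbb{C}[\mathcal{S}_N]$ whose symmetry class $\mathcal{H}_{\mathcal{R}}$ contains $U$ satisfies $\mathcal{R}_U\subseteq\mathcal{R}$.
   Context: $\mathcal{H}$ is the complex vector space with basis the symbols $|\sigma\rangle=|\sigma(1),\ldots,\sigma(N)\rangle$, $\sigma$ running over all functions $\{1,\ldots,N\}\to\{1,2\}$. For natural numbers $r_1,r_2$ (zero allowed) with $r_1+r_2=N$, $\mathcal{H}^{(r_1,r_2)}$ is the complex span of all $|\sigma\rangle$ with $|\sigma^{-1}(1)|=r_1$ and $|\sigma^{-1}(2)|=r_2$. $\mathcal{S}_N$ is the symmetric group on $\{1,\ldots,N\}$ with product $(p\circ q)(i)=p(q(i))$, and $\mathbb{C}[\mathcal{S}_N]$ is its complex group ring. It acts on $\mathcal{H}$ by linear extension of $p|\sigma\rangle := |\sigma\circ p^{-1}\rangle$. $\mathcal{S}_{r_1,r_2}\cong\mathcal{S}_{r_1}\times\mathcal{S}_{r_2}$ is the Young subgroup of all permutations that permute $\{1,\ldots,r_1\}$ and $\{r_1+1,\ldots,N\}$ each within itself,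 and $1_{\mathcal{S}_{r_1,r_2}} := \frac{1}{r_1!\,r_2!}\sum_{s\in\mathcal{S}_{r_1,r_2}}s$. $\mathfrak{R}_{r_1,r_2}$ is the set of the lexicographically smallest elements (permutations written as lists $(p(1),\ldots,p(N))$) of the left cosets $p\cdot\mathcal{S}_{r_1,r_2}$, and $\mathcal{L}_{\mathbb{C}}$ denotes complex linear span. Let $|\tau_0\rangle := |1,\ldots,1,2,\ldots,2\rangle$ ($r_1$ ones followed by $r_2$ twos). Every $v\in\mathcal{H}^{(r_1,r_2)}$ can be written as $v=a_v\cdot 1_{\mathcal{S}_{r_1,r_2}}|\tau_0\rangle$ with a unique $a_v\in\mathcal{L}_{\mathbb{C}}\mathfrak{R}_{r_1,r_2}$, and one sets $\mathcal{R}_v := a_v\cdot 1_{\mathcal{S}_{r_1,r_2}}\cdot\mathbb{C}[\mathcal{S}_N]$. For a right ideal $\mathcal{R}\subseteq\mathbb{C}[\mathcal{S}_N]$, the symmetry class of $\mathcal{H}$ defined by $\mathcal{R}$ is $\mathcal{H}_{\mathcal{R}} := \{au\in\mathcal{H}\mid a\in\mathcal{R},\,u\in\mathcal{H}\}$. *)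

theory Defs
  imports
    Complex_Main
    "HOL-Algebra.Sym_Groups"
    "HOL-Algebra.Ring"
    "HOL-Algebra.AbelCoset"
    "HOL-Library.Function_Algebras"
    "HOL-Library.Set_Algebras"
    "HOL-Library.FuncSet"
begin

section \<open>Free complex vector spaces on finite sets of symbols\<close>

text \<open>
  Formal linear combinations of symbols from a finite set are represented by their coefficient
  functions.  The library instance on function types provides the pointwise addition; its pointwise
  multiplication is never used below.
\<close>

definition cscale :: "complex \<Rightarrow> ('a \<Rightarrow> complex) \<Rightarrow> 'a \<Rightarrow> complex" where
  "cscale c f = (\<lambda>x. c * f x)"

interpretation cfun: vector_space cscale
  by unfold_locales (auto simp: cscale_def fun_eq_iff algebra_simps)

definition ket :: "'a \<Rightarrow> 'a \<Rightarrow> complex" where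
  "ket s = (\<lambda>t. if t = s then 1 else 0)"

section \<open>Group ring and right ideals\<close>

text \<open>For finite groups only: the sums are over the whole carrier.\<close>

definition group_ring :: "('g, 'm) monoid_scheme \<Rightarrow> ('g \<Rightarrow> complex) ring" where
  "group_ring G =
    \<lparr> carrier = cfun.span (ket ` carrier G),
      mult = (\<lambda>a b. \<Sum>p\<in>carrier G. \<Sum>q\<in>carrier G. cscale (a p * b q) (ket (p \<otimes>\<^bsub>G\<^esub> q))),
      one = ket \<one>\<^bsub>G\<^esub>,
      zero = 0,
      add = (+) \<rparr>"

abbreviation sym_group_ring :: "nat \<Rightarrow> ((nat \<Rightarrow> nat) \<Rightarrow> complex) ring" where
  "sym_group_ring N \<equiv> group_ring (sym_group N)"

definition right_ideal :: "'a set \<Rightarrow> ('a, 'm) ring_scheme \<Rightarrow> bool" where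
  "right_ideal I R \<longleftrightarrow>
     additive_subgroup I R \<and> (\<forall>a\<in>I. \<forall>x\<in>carrier R. a \<otimes>\<^bsub>R\<^esub> x \<in> I)"

section \<open>The space H and its weight spaces\<close>

text \<open>
  Functions from \<open>{1..N}\<close> to \<open>{1,2}\<close> are extensional functions on \<open>nat\<close>.  Permutations of
  \<open>{1..N}\<close> fix all other numbers, so composing with them preserves extensionality.
\<close>

definition spin_configs :: "nat \<Rightarrow> (nat \<Rightarrow> nat) set" where
  "spin_configs N = {1..N} \<rightarrow>\<^sub>E {1, 2}"

definition spin_space :: "nat \<Rightarrow> ((nat \<Rightarrow> nat) \<Rightarrow> complex) set" where
  "spin_space N = cfun.span (ket ` spin_configs N)"

definition weight_configs :: "nat \<Rightarrow> nat \<Rightarrow> (nat \<Rightarrow> nat) set" where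
  "weight_configs r1 r2 = {\<sigma> \<in> spin_configs (r1 + r2).
     card {i \<in> {1..r1 + r2}. \<sigma> i = 1} = r1 \<and> card {i \<in> {1..r1 + r2}. \<sigma> i = 2} = r2}"

definition weight_space :: "nat \<Rightarrow> nat \<Rightarrow> ((nat \<Rightarrow> nat) \<Rightarrow> complex) set" where
  "weight_space r1 r2 = cfun.span (ket ` weight_configs r1 r2)"

text \<open>The bilinear extension of the action of a permutation \<open>p\<close> sending the basis vector of
  \<open>\<sigma>\<close> to that of \<open>\<sigma> \<circ> p\<^sup>-\<^sup>1\<close>.\<close>

definition act :: "nat \<Rightarrow> ((nat \<Rightarrow> nat) \<Rightarrow> complex) \<Rightarrow> ((nat \<Rightarrow> nat) \<Rightarrow> complex)
    \<Rightarrow> (nat \<Rightarrow> nat) \<Rightarrow> complex" where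
  "act N a u = (\<Sum>p\<in>carrier (sym_group N). \<Sum>\<sigma>\<in>spin_configs N.
      cscale (a p * u \<sigma>) (ket (\<sigma> \<circ> inv\<^bsub>sym_group N\<^esub> p)))"

definition symmetry_class :: "nat \<Rightarrow> ((nat \<Rightarrow> nat) \<Rightarrow> complex) set
    \<Rightarrow> ((nat \<Rightarrow> nat) \<Rightarrow> complex) set" where
  "symmetry_class N R = {act N a u | a u. a \<in> R \<and> u \<in> spin_space N}"

section \<open>Young subgroup and minimal coset representatives\<close>

definition young_subgroup :: "nat \<Rightarrow> nat \<Rightarrow> (nat \<Rightarrow> nat) set" where
  "young_subgroup r1 r2 = {p \<in> carrier (sym_group (r1 + r2)).
      p ` {1..r1} = {1..r1} \<and> p ` {r1 + 1..r1 + r2} = {r1 + 1..r1 + r2}}"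

definition young_symmetrizer :: "nat \<Rightarrow> nat \<Rightarrow> (nat \<Rightarrow> nat) \<Rightarrow> complex" where
  "young_symmetrizer r1 r2 =
     cscale (1 / (fact r1 * fact r2)) (\<Sum>s\<in>young_subgroup r1 r2. ket s)"

definition perm_word :: "nat \<Rightarrow> (nat \<Rightarrow> nat) \<Rightarrow> nat list" where
  "perm_word N p = map p [1..<N + 1]"

text \<open>\<open>lexordp_eq\<close> is the library's reflexive lexicographic order on lists.\<close>

definition min_coset_reps :: "nat \<Rightarrow> nat \<Rightarrow> (nat \<Rightarrow> nat) set" where
  "min_coset_reps r1 r2 = {p. \<exists>q \<in> carrier (sym_group (r1 + r2)).
      p \<in> q <#\<^bsub>sym_group (r1 + r2)\<^esub> young_subgroup r1 r2 \<and>
      (\<forall>p' \<in> q <#\<^bsub>sym_group (r1 + r2)\<^esub> young_subgroup r1 r2.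
         lexordp_eq (perm_word (r1 + r2) p) (perm_word (r1 + r2) p'))}"

section \<open>The right ideal of a vector\<close>

definition \<tau>0 :: "nat \<Rightarrow> nat \<Rightarrow> nat \<Rightarrow> nat" where
  "\<tau>0 r1 r2 = (\<lambda>i\<in>{1..r1 + r2}. if i \<le> r1 then 1 else 2)"

definition vec_coeff :: "nat \<Rightarrow> nat \<Rightarrow> ((nat \<Rightarrow> nat) \<Rightarrow> complex) \<Rightarrow> (nat \<Rightarrow> nat) \<Rightarrow> complex" where
  "vec_coeff r1 r2 v = (THE a. a \<in> cfun.span (ket ` min_coset_reps r1 r2) \<and>
     v = act (r1 + r2) (a \<otimes>\<^bsub>sym_group_ring (r1 + r2)\<^esub> young_symmetrizer r1 r2) (ket (\<tau>0 r1 r2)))"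

definition vec_ideal :: "nat \<Rightarrow> nat \<Rightarrow> ((nat \<Rightarrow> nat) \<Rightarrow> complex) \<Rightarrow> ((nat \<Rightarrow> nat) \<Rightarrow> complex) set" where
  "vec_ideal r1 r2 v =
     {vec_coeff r1 r2 v \<otimes>\<^bsub>sym_group_ring (r1 + r2)\<^esub> young_symmetrizer r1 r2
        \<otimes>\<^bsub>sym_group_ring (r1 + r2)\<^esub> x | x. x \<in> carrier (sym_group_ring (r1 + r2))}"

section \<open>Well-definedness\<close>

text \<open>
  The group ring is a ring, \<open>vec_ideal\<close> is a right ideal, finite sums of right ideals are right
  ideals, and the description in \<open>vec_coeff_def\<close> is proper (\<open>vec_coeff_ex1\<close>).
\<close>

lemma sum_fun_apply: "(\<Sum>i\<in>A. f i) x = (\<Sum>i\<in>A. (f i x :: 'a::comm_monoid_add))"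
  by (induction A rule: infinite_finite_induct) (auto simp: plus_fun_def zero_fun_def)

lemma cscale_apply: "cscale c f x = c * f x" by (simp add: cscale_def)

lemma in_span_ket:
  assumes "finite A"
  shows "f \<in> cfun.span (ket ` A) \<longleftrightarrow> (\<forall>x. x \<notin> A \<longrightarrow> f x = 0)"
proof
  assume "f \<in> cfun.span (ket ` A)"
  then show "\<forall>x. x \<notin> A \<longrightarrow> f x = 0"
    by (induction rule: cfun.span_induct_alt) (auto simp: ket_def cscale_def zero_fun_def plus_fun_def split: if_splits)
next
  assume *: "\<forall>x. x \<notin> A \<longrightarrow> f x = 0"
  have "f = (\<Sum>a\<in>A. cscale (f a) (ket a))"
  proof
    fix x
    have "(\<Sum>a\<in>A. cscale (f a) (ket a)) x = (\<Sum>a\<in>A. if a = x then f a else 0)"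
      unfolding sum_fun_apply by (intro sum.cong) (auto simp: cscale_def ket_def)
    also have "\<dots> = f x" using * assms by (simp add: sum.delta)
    finally show "f x = (\<Sum>a\<in>A. cscale (f a) (ket a)) x" by simp
  qed
  also have "\<dots> \<in> cfun.span (ket ` A)"
    by (intro cfun.span_sum cfun.span_scale cfun.span_base) auto
  finally show "f \<in> cfun.span (ket ` A)" .
qed

lemma sum_ket: assumes "finite A" shows "(\<Sum>x\<in>A. ket y x * h x) = (if y \<in> A then h y else 0)"
proof -
  have "(\<Sum>x\<in>A. ket y x * h x) = (\<Sum>x\<in>A. if x = y then h x else 0)"
    by (intro sum.cong) (auto simp: ket_def)
  then show ?thesis using assms by (simp add: sum.delta)
qed

lemma sum_ket': assumes "finite A" shows "(\<Sum>x\<in>A. h x * ket y x) = (if y \<in> A then h y else 0)"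
  using sum_ket[OF assms, of y h] by (simp add: mult.commute)

lemma group_ring_sel:
  "carrier (group_ring G) = cfun.span (ket ` carrier G)"
  "\<one>\<^bsub>group_ring G\<^esub> = ket \<one>\<^bsub>G\<^esub>" "\<zero>\<^bsub>group_ring G\<^esub> = 0" "add (group_ring G) = (+)"
  by (simp_all add: group_ring_def)

lemma group_ring_mult_apply:
  "(a \<otimes>\<^bsub>group_ring G\<^esub> b) r
     = (\<Sum>p\<in>carrier G. \<Sum>q\<in>carrier G. a p * b q * ket (p \<otimes>\<^bsub>G\<^esub> q) r)"
  by (simp add: group_ring_def sum_fun_apply cscale_apply)

lemma sum_swap3:
  "(\<Sum>r\<in>C. (\<Sum>p\<in>A. \<Sum>q\<in>B. f p q * k p q r) * h r)
   = (\<Sum>p\<in>A. \<Sum>q\<in>B. (f p q :: complex) * (\<Sum>r\<in>C. k p q r * h r))"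
proof -
  have "(\<Sum>r\<in>C. (\<Sum>p\<in>A. \<Sum>q\<in>B. f p q * k p q r) * h r)
      = (\<Sum>r\<in>C. \<Sum>p\<in>A. \<Sum>q\<in>B. f p q * k p q r * h r)"
    by (simp add: sum_distrib_right)
  also have "\<dots> = (\<Sum>p\<in>A. \<Sum>r\<in>C. \<Sum>q\<in>B. f p q * k p q r * h r)" by (rule sum.swap)
  also have "\<dots> = (\<Sum>p\<in>A. \<Sum>q\<in>B. \<Sum>r\<in>C. f p q * k p q r * h r)"
    by (intro sum.cong refl sum.swap)
  finally show ?thesis by (simp add: sum_distrib_left mult.assoc)
qed

lemma group_ring_mult_sum:
  assumes "group G" "finite (carrier G)"
  shows "(\<Sum>r\<in>carrier G. (a \<otimes>\<^bsub>group_ring G\<^esub> b) r * h r)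
     = (\<Sum>p\<in>carrier G. \<Sum>q\<in>carrier G. a p * b q * h (p \<otimes>\<^bsub>G\<^esub> q))"
proof -
  interpret group G by fact
  show ?thesis unfolding group_ring_mult_apply sum_swap3
    by (intro sum.cong refl) (use assms in \<open>simp add: sum_ket\<close>)
qed

lemma group_ring_mult_assoc:
  assumes "group G" "finite (carrier G)"
  shows "(a \<otimes>\<^bsub>group_ring G\<^esub> b) \<otimes>\<^bsub>group_ring G\<^esub> c
       = a \<otimes>\<^bsub>group_ring G\<^esub> (b \<otimes>\<^bsub>group_ring G\<^esub> c)"
proof
  interpret group G by fact
  fix s
  let ?S = "carrier G"
  let ?m = "\<lambda>a b. a \<otimes>\<^bsub>group_ring G\<^esub> b"
  have "?m (?m a b) c s = (\<Sum>r\<in>?S. ?m a b r * (\<Sum>t\<in>?S. c t * ket (r \<otimes>\<^bsub>G\<^esub> t) s))"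
    by (subst group_ring_mult_apply) (simp add: sum_distrib_left mult.assoc)
  also have "\<dots> = (\<Sum>p\<in>?S. \<Sum>q\<in>?S. \<Sum>t\<in>?S. a p * b q * c t * ket (p \<otimes>\<^bsub>G\<^esub> q \<otimes>\<^bsub>G\<^esub> t) s)"
    by (subst group_ring_mult_sum[OF assms]) (simp add: sum_distrib_left mult.assoc)
  also have "\<dots> = (\<Sum>p\<in>?S. \<Sum>q\<in>?S. \<Sum>t\<in>?S. a p * (b q * c t * ket (p \<otimes>\<^bsub>G\<^esub> (q \<otimes>\<^bsub>G\<^esub> t)) s))"
    by (intro sum.cong refl) (simp add: m_assoc mult.assoc)
  also have "\<dots> = (\<Sum>p\<in>?S. a p * (\<Sum>q\<in>?S. \<Sum>t\<in>?S. b q * c t * ket (p \<otimes>\<^bsub>G\<^esub> (q \<otimes>\<^bsub>G\<^esub> t)) s))"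
    by (simp add: sum_distrib_left)
  also have "\<dots> = (\<Sum>p\<in>?S. a p * (\<Sum>r\<in>?S. ?m b c r * ket (p \<otimes>\<^bsub>G\<^esub> r) s))"
    by (simp add: group_ring_mult_sum[OF assms])
  also have "\<dots> = ?m a (?m b c) s"
    by (subst (2) group_ring_mult_apply) (simp add: sum_distrib_left mult.assoc)
  finally show "?m (?m a b) c s = ?m a (?m b c) s" .
qed

lemma group_ring_distrib:
  "(a + b) \<otimes>\<^bsub>group_ring G\<^esub> c = (a \<otimes>\<^bsub>group_ring G\<^esub> c) + (b \<otimes>\<^bsub>group_ring G\<^esub> c)"
  "a \<otimes>\<^bsub>group_ring G\<^esub> (b + c) = (a \<otimes>\<^bsub>group_ring G\<^esub> b) + (a \<otimes>\<^bsub>group_ring G\<^esub> c)"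
  by (auto simp: fun_eq_iff group_ring_mult_apply algebra_simps sum.distrib)

lemma group_ring_closed:
  assumes "group G"
  shows "a \<otimes>\<^bsub>group_ring G\<^esub> b \<in> carrier (group_ring G)"
proof -
  interpret group G by fact
  show ?thesis by (simp add: group_ring_def) (intro cfun.span_sum cfun.span_scale cfun.span_base imageI m_closed)
qed

lemma group_ring_ring:
  assumes "group G" "finite (carrier G)"
  shows "ring (group_ring G)"
proof -
  interpret group G by fact
  note sel = group_ring_sel
  show ?thesis
  proof (intro ringI abelian_groupI monoidI; (simp only: sel)?)
    fix x assume x: "x \<in> cfun.span (ket ` carrier G)"
    show "\<exists>y\<in>cfun.span (ket ` carrier G). y + x = 0"
      by (rule bexI[of _ "- x"]) (auto intro: cfun.span_neg x)
    have x0: "x s = 0" if "s \<notin> carrier G" for s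
      using x that by (simp add: in_span_ket[OF assms(2)])
    show "ket \<one>\<^bsub>G\<^esub> \<otimes>\<^bsub>group_ring G\<^esub> x = x"
    proof
      fix s
      have "(ket \<one>\<^bsub>G\<^esub> \<otimes>\<^bsub>group_ring G\<^esub> x) s
          = (\<Sum>p\<in>carrier G. ket \<one>\<^bsub>G\<^esub> p * (\<Sum>q\<in>carrier G. x q * ket (p \<otimes>\<^bsub>G\<^esub> q) s))"
        by (simp add: group_ring_mult_apply sum_distrib_left mult.assoc)
      also have "\<dots> = (\<Sum>q\<in>carrier G. x q * ket q s)"
        by (subst sum_ket) (use assms in auto)
      also have "\<dots> = (\<Sum>q\<in>carrier G. if q = s then x q else 0)"
        by (intro sum.cong) (auto simp: ket_def)
      also have "\<dots> = x s" using x0 assms by (simp add: sum.delta)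
      finally show "(ket \<one>\<^bsub>G\<^esub> \<otimes>\<^bsub>group_ring G\<^esub> x) s = x s" .
    qed
    show "x \<otimes>\<^bsub>group_ring G\<^esub> ket \<one>\<^bsub>G\<^esub> = x"
    proof
      fix s
      have "(x \<otimes>\<^bsub>group_ring G\<^esub> ket \<one>\<^bsub>G\<^esub>) s
          = (\<Sum>p\<in>carrier G. x p * (\<Sum>q\<in>carrier G. ket \<one>\<^bsub>G\<^esub> q * ket (p \<otimes>\<^bsub>G\<^esub> q) s))"
        by (simp add: group_ring_mult_apply sum_distrib_left mult.assoc)
      also have "\<dots> = (\<Sum>q\<in>carrier G. x q * ket q s)"
        by (subst sum_ket) (use assms in auto)
      also have "\<dots> = (\<Sum>q\<in>carrier G. if q = s then x q else 0)"
        by (intro sum.cong) (auto simp: ket_def)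
      also have "\<dots> = x s" using x0 assms by (simp add: sum.delta)
      finally show "(x \<otimes>\<^bsub>group_ring G\<^esub> ket \<one>\<^bsub>G\<^esub>) s = x s" .
    qed
  qed (use group_ring_closed[OF assms(1)] in \<open>auto simp: sel ac_simps group_ring_distrib
        group_ring_mult_assoc[OF assms] intro: cfun.span_add cfun.span_zero cfun.span_base\<close>)
qed

lemma sym_group_finite: "finite (carrier (sym_group N))"
  by (simp add: sym_group_def finite_permutations)

lemma group_ring_minus:
  assumes "group G" "finite (carrier G)" "x \<in> carrier (group_ring G)"
  shows "\<ominus>\<^bsub>group_ring G\<^esub> x = - x"
proof -
  interpret ring "group_ring G" by (rule group_ring_ring) fact+
  show ?thesis
    by (rule minus_equality) (use assms in \<open>auto simp: group_ring_sel intro: cfun.span_neg\<close>)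
qed

lemma right_ideal_iff:
  assumes "group G" "finite (carrier G)"
  shows "right_ideal I (group_ring G) \<longleftrightarrow> I \<subseteq> carrier (group_ring G) \<and> 0 \<in> I
    \<and> (\<forall>a\<in>I. \<forall>b\<in>I. a + b \<in> I) \<and> (\<forall>a\<in>I. - a \<in> I)
    \<and> (\<forall>a\<in>I. \<forall>x\<in>carrier (group_ring G). a \<otimes>\<^bsub>group_ring G\<^esub> x \<in> I)"
proof -
  interpret ring "group_ring G" by (rule group_ring_ring) fact+
  have "additive_subgroup I (group_ring G) \<longleftrightarrow> I \<subseteq> carrier (group_ring G) \<and> 0 \<in> I
    \<and> (\<forall>a\<in>I. \<forall>b\<in>I. a + b \<in> I) \<and> (\<forall>a\<in>I. - a \<in> I)" (is "?L \<longleftrightarrow> ?R")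
  proof
    assume L: ?L
    interpret additive_subgroup I "group_ring G" by fact
    have "- a \<in> I" if "a \<in> I" for a
      using a_inv_closed[OF that] group_ring_minus[OF assms, of a] a_subset that by auto
    then show ?R
      using a_subset zero_closed a_closed by (auto simp: group_ring_sel)
  next
    assume R: ?R
    have "\<ominus>\<^bsub>group_ring G\<^esub> a \<in> I" if "a \<in> I" for a
      using R that group_ring_minus[OF assms, of a] by auto
    then show ?L
      by (intro additive_subgroupI add.subgroupI) (use R in \<open>auto simp: group_ring_sel a_inv_def\<close>)
  qed
  then show ?thesis by (auto simp: right_ideal_def)
qed

lemma vec_ideal_right_ideal: "right_ideal (vec_ideal r1 r2 v) (sym_group_ring (r1 + r2))"
proof -
  let ?G = "sym_group (r1 + r2)"
  note G = sym_group_is_group[of "r1 + r2"] sym_group_finite[of "r1 + r2"]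
  interpret ring "group_ring ?G" by (rule group_ring_ring[OF G])
  define w where "w = vec_coeff r1 r2 v \<otimes>\<^bsub>group_ring ?G\<^esub> young_symmetrizer r1 r2"
  have w: "w \<in> carrier (group_ring ?G)" unfolding w_def by (rule group_ring_closed[OF G(1)])
  have eq: "vec_ideal r1 r2 v = (\<lambda>x. w \<otimes>\<^bsub>group_ring ?G\<^esub> x) ` carrier (group_ring ?G)"
    by (auto simp: vec_ideal_def w_def)
  have "0 = w \<otimes>\<^bsub>group_ring ?G\<^esub> 0"
    using r_null[OF w] by (simp add: group_ring_sel)
  moreover have "0 \<in> carrier (group_ring ?G)" using zero_closed by (simp add: group_ring_sel)
  ultimately have z: "0 \<in> vec_ideal r1 r2 v" unfolding eq by (rule image_eqI)
  have n: "- a \<in> vec_ideal r1 r2 v" if "a \<in> vec_ideal r1 r2 v" for a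
  proof -
    from that obtain x where x: "x \<in> carrier (group_ring ?G)" "a = w \<otimes>\<^bsub>group_ring ?G\<^esub> x"
      unfolding eq by blast
    have "w \<otimes>\<^bsub>group_ring ?G\<^esub> (- x) = - a"
      using r_minus[OF w x(1)] x w by (simp add: group_ring_minus[OF G])
    moreover have "- x \<in> carrier (group_ring ?G)"
      using x by (simp add: group_ring_sel cfun.span_neg)
    ultimately show ?thesis unfolding eq by (metis image_eqI)
  qed
  have p: "a + b \<in> vec_ideal r1 r2 v" if ab: "a \<in> vec_ideal r1 r2 v" "b \<in> vec_ideal r1 r2 v" for a b
  proof -
    from ab obtain x y where "x \<in> carrier (group_ring ?G)" "a = w \<otimes>\<^bsub>group_ring ?G\<^esub> x"
      "y \<in> carrier (group_ring ?G)" "b = w \<otimes>\<^bsub>group_ring ?G\<^esub> y"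
      unfolding eq by blast
    moreover from this have "x + y \<in> carrier (group_ring ?G)"
      by (simp add: group_ring_sel cfun.span_add)
    ultimately show ?thesis unfolding eq by (metis image_eqI group_ring_distrib(2))
  qed
  have m: "a \<otimes>\<^bsub>group_ring ?G\<^esub> y \<in> vec_ideal r1 r2 v" if "a \<in> vec_ideal r1 r2 v" for a y
  proof -
    from that obtain x where x: "a = w \<otimes>\<^bsub>group_ring ?G\<^esub> x" unfolding eq by blast
    show ?thesis unfolding eq x group_ring_mult_assoc[OF G]
      by (rule imageI) (rule group_ring_closed[OF G(1)])
  qed
  have s: "vec_ideal r1 r2 v \<subseteq> carrier (group_ring ?G)"
    unfolding eq using group_ring_closed[OF G(1)] by blast
  show ?thesis unfolding right_ideal_iff[OF G] using s z n p m by blast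
qed

lemma right_ideal_sum:
  assumes G: "group G" "finite (carrier G)"
    and "finite K" "\<And>k. k \<in> K \<Longrightarrow> right_ideal (I k) (group_ring G)"
  shows "right_ideal (\<Sum>k\<in>K. I k) (group_ring G)"
  using assms(3,4)
proof (induction K)
  case empty
  have "0 \<otimes>\<^bsub>group_ring G\<^esub> x = 0" for x
    by (auto simp: fun_eq_iff group_ring_mult_apply)
  then show ?case by (auto simp: right_ideal_iff[OF G] group_ring_sel cfun.span_zero)
next
  case (insert k K)
  let ?J = "\<Sum>k\<in>K. I k"
  from insert have "right_ideal ?J (group_ring G)" "right_ideal (I k) (group_ring G)" by auto
  note 1 = this[unfolded right_ideal_iff[OF G]]
  have "right_ideal (I k + ?J) (group_ring G)"
    unfolding right_ideal_iff[OF G]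
  proof (intro conjI ballI subsetI)
    show "0 \<in> I k + ?J" using 1 set_plus_intro[of 0 "I k" 0 ?J] by simp
  next
    fix x assume "x \<in> I k + ?J"
    then obtain y z where "x = y + z" "y \<in> I k" "z \<in> ?J" by (elim set_plus_elim)
    then show "x \<in> carrier (group_ring G)" using 1 by (auto simp: group_ring_sel intro!: cfun.span_add)
  next
    fix x x' assume "x \<in> I k + ?J" "x' \<in> I k + ?J"
    then obtain y z y' z' where "x = y + z" "y \<in> I k" "z \<in> ?J" "x' = y' + z'" "y' \<in> I k" "z' \<in> ?J"
      by (elim set_plus_elim) blast
    moreover have "y + z + (y' + z') = (y + y') + (z + z')" by (simp add: ac_simps)
    ultimately show "x + x' \<in> I k + ?J" using 1 by (metis set_plus_intro)
  next
    fix x assume "x \<in> I k + ?J"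
    then obtain y z where "x = y + z" "y \<in> I k" "z \<in> ?J" by (elim set_plus_elim)
    moreover have "- (y + z) = - y + - z" by simp
    ultimately show "- x \<in> I k + ?J" using 1 by (metis set_plus_intro)
  next
    fix x c assume "x \<in> I k + ?J" "c \<in> carrier (group_ring G)"
    then obtain y z where "x = y + z" "y \<in> I k" "z \<in> ?J" by (elim set_plus_elim)
    then show "x \<otimes>\<^bsub>group_ring G\<^esub> c \<in> I k + ?J"
      using 1 \<open>c \<in> _\<close> by (auto simp: group_ring_distrib intro!: set_plus_intro)
  qed
  then show ?case using insert by simp
qed

lemma spin_configs_finite: "finite (spin_configs N)"
  by (simp add: spin_configs_def finite_PiE)

lemma spin_configs_comp:
  assumes "\<sigma> \<in> spin_configs N" "p \<in> carrier (sym_group N)"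
  shows "\<sigma> \<circ> inv\<^bsub>sym_group N\<^esub> p \<in> spin_configs N"
proof -
  have "inv' p permutes {1..N}" using assms(2) permutes_inv by (auto simp: sym_group_carrier)
  then show ?thesis using assms
    by (auto simp: spin_configs_def PiE_def extensional_def Pi_def permutes_in_image permutes_not_in simp del: atLeastAtMost_iff)
qed

lemma act_apply:
  "act N a u \<tau> = (\<Sum>p\<in>carrier (sym_group N). \<Sum>\<sigma>\<in>spin_configs N.
      a p * u \<sigma> * ket (\<sigma> \<circ> inv\<^bsub>sym_group N\<^esub> p) \<tau>)"
  by (simp add: act_def sum_fun_apply cscale_apply)

lemma act_mult:
  "act N (a \<otimes>\<^bsub>sym_group_ring N\<^esub> b) u = act N a (act N b u)"
proof (rule ext)
  fix \<tau>
  let ?G = "sym_group N"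
  let ?S = "carrier ?G" and ?C = "spin_configs N"
  interpret group ?G by (rule sym_group_is_group)
  have fin: "finite ?S" by (rule sym_group_finite)
  have invm: "inv\<^bsub>?G\<^esub> (p \<otimes>\<^bsub>?G\<^esub> q) = inv\<^bsub>?G\<^esub> q \<circ> inv\<^bsub>?G\<^esub> p" if "p \<in> ?S" "q \<in> ?S" for p q
    using inv_mult_group[OF that] by (simp only: sym_group_mult)
  have inner: "(\<Sum>q\<in>?S. \<Sum>\<sigma>\<in>?C. b q * u \<sigma> * ket ((\<sigma> \<circ> inv\<^bsub>?G\<^esub> q) \<circ> inv\<^bsub>?G\<^esub> p) \<tau>)
      = (\<Sum>\<rho>\<in>?C. act N b u \<rho> * ket (\<rho> \<circ> inv\<^bsub>?G\<^esub> p) \<tau>)" for p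
    unfolding act_apply sum_swap3
    by (intro sum.cong refl)
      (simp add: sum_ket[OF spin_configs_finite] spin_configs_comp del: sym_group_inv_equality)
  have "act N (a \<otimes>\<^bsub>sym_group_ring N\<^esub> b) u \<tau>
      = (\<Sum>r\<in>?S. (a \<otimes>\<^bsub>sym_group_ring N\<^esub> b) r * (\<Sum>\<sigma>\<in>?C. u \<sigma> * ket (\<sigma> \<circ> inv\<^bsub>?G\<^esub> r) \<tau>))"
    by (simp only: act_apply sum_distrib_left mult.assoc)
  also have "\<dots> = (\<Sum>p\<in>?S. \<Sum>q\<in>?S. a p * b q * (\<Sum>\<sigma>\<in>?C. u \<sigma> * ket (\<sigma> \<circ> inv\<^bsub>?G\<^esub> (p \<otimes>\<^bsub>?G\<^esub> q)) \<tau>))"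
    by (rule group_ring_mult_sum[OF is_group fin])
  also have "\<dots> = (\<Sum>p\<in>?S. a p * (\<Sum>q\<in>?S. \<Sum>\<sigma>\<in>?C. b q * u \<sigma> * ket ((\<sigma> \<circ> inv\<^bsub>?G\<^esub> q) \<circ> inv\<^bsub>?G\<^esub> p) \<tau>))"
    unfolding sum_distrib_left
    by (intro sum.cong refl) (simp add: invm o_assoc mult.assoc del: sym_group_inv_equality)
  also have "\<dots> = (\<Sum>p\<in>?S. a p * (\<Sum>\<rho>\<in>?C. act N b u \<rho> * ket (\<rho> \<circ> inv\<^bsub>?G\<^esub> p) \<tau>))"
    by (simp only: inner)
  also have "\<dots> = act N a (act N b u) \<tau>"
    unfolding act_apply[of N a] by (simp only: sum_distrib_left mult.assoc)
  finally show "act N (a \<otimes>\<^bsub>sym_group_ring N\<^esub> b) u \<tau> = act N a (act N b u) \<tau>" .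
qed

lemma act_ket:
  assumes "\<sigma> \<in> spin_configs N"
  shows "act N a (ket \<sigma>) \<tau> = (\<Sum>p\<in>carrier (sym_group N). a p * ket (\<sigma> \<circ> inv\<^bsub>sym_group N\<^esub> p) \<tau>)"
  unfolding act_apply mult.assoc sum_distrib_left[symmetric] using assms
  by (intro sum.cong refl) (simp add: sum_ket[OF spin_configs_finite])

lemma tau0_config: "\<tau>0 r1 r2 \<in> spin_configs (r1 + r2)"
  by (auto simp: \<tau>0_def spin_configs_def)

lemma young_subgroup_stab:
  "young_subgroup r1 r2 = {p \<in> carrier (sym_group (r1 + r2)). \<tau>0 r1 r2 \<circ> p = \<tau>0 r1 r2}"
proof -
  let ?A = "{1..r1}" and ?B = "{r1 + 1..r1 + r2}" and ?N = "r1 + r2"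
  have "(p ` ?A = ?A \<and> p ` ?B = ?B) \<longleftrightarrow> \<tau>0 r1 r2 \<circ> p = \<tau>0 r1 r2" if p: "p permutes {1..?N}" for p
  proof
    assume h: "p ` ?A = ?A \<and> p ` ?B = ?B"
    show "\<tau>0 r1 r2 \<circ> p = \<tau>0 r1 r2"
    proof
      fix i
      consider "i \<in> ?A" | "i \<in> ?B" | "i \<notin> {1..?N}" by force
      then show "(\<tau>0 r1 r2 \<circ> p) i = \<tau>0 r1 r2 i"
      proof cases
        case 1 then have "p i \<in> ?A" using h by blast
        then show ?thesis using 1 by (auto simp: \<tau>0_def)
      next
        case 2 then have "p i \<in> ?B" using h by blast
        then show ?thesis using 2 by (auto simp: \<tau>0_def)
      next
        case 3 then show ?thesis using permutes_not_in[OF p 3] by simp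
      qed
    qed
  next
    assume h: "\<tau>0 r1 r2 \<circ> p = \<tau>0 r1 r2"
    have e: "\<tau>0 r1 r2 (p i) = \<tau>0 r1 r2 i" for i using fun_cong[OF h, of i] by simp
    have m: "p i \<in> {1..?N}" if "i \<in> {1..?N}" for i using p that by (metis permutes_in_image)
    have tA: "j \<in> ?A \<longleftrightarrow> \<tau>0 r1 r2 j = 1" and tB: "j \<in> ?B \<longleftrightarrow> \<tau>0 r1 r2 j = 2" if "j \<in> {1..?N}" for j
      using that by (auto simp: \<tau>0_def)
    have AN: "?A \<subseteq> {1..?N}" and BN: "?B \<subseteq> {1..?N}" by auto
    have "p ` ?A \<subseteq> ?A"
    proof
      fix y assume "y \<in> p ` ?A"
      then obtain i where i: "i \<in> ?A" "y = p i" by blast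
      then have "i \<in> {1..?N}" using AN by blast
      then show "y \<in> ?A" using tA[of i] tA[of "p i"] e[of i] m[of i] i by metis
    qed
    moreover have "p ` ?B \<subseteq> ?B"
    proof
      fix y assume "y \<in> p ` ?B"
      then obtain i where i: "i \<in> ?B" "y = p i" by blast
      then have "i \<in> {1..?N}" using BN by blast
      then show "y \<in> ?B" using tB[of i] tB[of "p i"] e[of i] m[of i] i by metis
    qed
    moreover have "inj p" using p by (rule permutes_inj)
    ultimately show "p ` ?A = ?A \<and> p ` ?B = ?B"
      using endo_inj_surj[of ?A p] endo_inj_surj[of ?B p] inj_on_subset[of p UNIV] by auto
  qed
  then show ?thesis unfolding young_subgroup_def
    by (intro Collect_cong conj_cong refl) (simp only: sym_group_carrier)
qed

lemma young_subgroup_subgroup: "subgroup (young_subgroup r1 r2) (sym_group (r1 + r2))"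
proof -
  let ?G = "sym_group (r1 + r2)" and ?t = "\<tau>0 r1 r2"
  interpret group ?G by (rule sym_group_is_group)
  show ?thesis
  proof (rule subgroupI)
    show "young_subgroup r1 r2 \<noteq> {}"
      using one_closed unfolding young_subgroup_stab sym_group_one by auto
    fix a assume a: "a \<in> young_subgroup r1 r2"
    then have "a \<circ> inv' a = id" by (auto simp: young_subgroup_stab sym_group_carrier permutes_inv_o)
    then have "?t \<circ> inv' a = ?t"
      using a unfolding young_subgroup_stab by (metis (mono_tags, lifting) comp_assoc comp_id mem_Collect_eq)
    then show "inv\<^bsub>?G\<^esub> a \<in> young_subgroup r1 r2"
      using a sym_group_inv_closed by (auto simp: young_subgroup_stab)
    fix b assume b: "b \<in> young_subgroup r1 r2"
    show "a \<otimes>\<^bsub>?G\<^esub> b \<in> young_subgroup r1 r2"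
      using a b m_closed[of a b] by (auto simp: young_subgroup_stab sym_group_mult o_assoc)
  qed (auto simp: young_subgroup_def)
qed

lemma perm_word_inj:
  assumes "p permutes {1..N}" "q permutes {1..N}" "perm_word N p = perm_word N q"
  shows "p = q"
proof
  fix i
  have "\<forall>i\<in>{1..N}. p i = q i" using assms(3) by (auto simp: perm_word_def)
  then show "p i = q i" using permutes_not_in[OF assms(1), of i] permutes_not_in[OF assms(2), of i]
    by (cases "i \<in> {1..N}") auto
qed

lemma lex_least:
  assumes "finite A" "A \<noteq> {}"
  shows "\<exists>m\<in>A. \<forall>x\<in>A. lexordp_eq (perm_word N m) (perm_word N x)"
  using assms
proof (induction rule: finite_ne_induct)
  case (singleton x) then show ?case by (simp add: lexordp_eq_refl)
next
  case (insert x F)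
  then obtain m where m: "m \<in> F" "\<forall>x\<in>F. lexordp_eq (perm_word N m) (perm_word N x)" by blast
  show ?case
  proof (cases "lexordp_eq (perm_word N m) (perm_word N x)")
    case True then show ?thesis using m by auto
  next
    case False
    then have "lexordp_eq (perm_word N x) (perm_word N m)" using lexordp_eq_linear by blast
    then show ?thesis using m by (auto intro!: bexI[of _ x] lexordp_eq_refl intro: lexordp_eq_trans)
  qed
qed

lemma reps_bij:
  "bij_betw (\<lambda>p. \<tau>0 r1 r2 \<circ> inv\<^bsub>sym_group (r1 + r2)\<^esub> p) (min_coset_reps r1 r2) (weight_configs r1 r2)"
proof -
  let ?N = "r1 + r2" and ?t = "\<tau>0 r1 r2" and ?Y = "young_subgroup r1 r2"
  let ?G = "sym_group ?N"
  interpret group ?G by (rule sym_group_is_group)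
  note sub = young_subgroup_subgroup[of r1 r2]
  have YG: "?Y \<subseteq> carrier ?G" using sub subgroup.subset by blast
  have lcos_self: "q \<in> q <#\<^bsub>?G\<^esub> ?Y" if "q \<in> carrier ?G" for q
    unfolding l_coset_def using subgroup.one_closed[OF sub] r_one[OF that] by blast
  have coset: "q <#\<^bsub>?G\<^esub> ?Y = p <#\<^bsub>?G\<^esub> ?Y" "p \<in> carrier ?G"
    if "q \<in> carrier ?G" "p \<in> q <#\<^bsub>?G\<^esub> ?Y" for p q
    using l_repr_independence[OF that(2,1) sub] l_coset_carrier[OF that(2,1) sub] by auto
  have rep: "p \<in> min_coset_reps r1 r2 \<longleftrightarrow> p \<in> carrier ?G \<and>
      (\<forall>p'\<in>p <#\<^bsub>?G\<^esub> ?Y. lexordp_eq (perm_word ?N p) (perm_word ?N p'))" for p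
  proof
    assume "p \<in> min_coset_reps r1 r2"
    then obtain q where q: "q \<in> carrier ?G" "p \<in> q <#\<^bsub>?G\<^esub> ?Y"
      "\<forall>p'\<in>q <#\<^bsub>?G\<^esub> ?Y. lexordp_eq (perm_word ?N p) (perm_word ?N p')"
      unfolding min_coset_reps_def by blast
    show "p \<in> carrier ?G \<and>
      (\<forall>p'\<in>p <#\<^bsub>?G\<^esub> ?Y. lexordp_eq (perm_word ?N p) (perm_word ?N p'))"
      using q(3) coset[OF q(1,2)] by simp
  next
    assume "p \<in> carrier ?G \<and>
      (\<forall>p'\<in>p <#\<^bsub>?G\<^esub> ?Y. lexordp_eq (perm_word ?N p) (perm_word ?N p'))"
    then show "p \<in> min_coset_reps r1 r2" unfolding min_coset_reps_def using lcos_self[of p] by blast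
  qed
  have inj: "p = q" if pq: "p \<in> min_coset_reps r1 r2" "q \<in> min_coset_reps r1 r2"
    "?t \<circ> inv\<^bsub>?G\<^esub> p = ?t \<circ> inv\<^bsub>?G\<^esub> q" for p q
  proof -
    have c: "p \<in> carrier ?G" "q \<in> carrier ?G" using that rep by auto
    define s where "s = inv\<^bsub>?G\<^esub> p \<otimes>\<^bsub>?G\<^esub> q"
    have s: "s \<in> carrier ?G" using c by (simp add: s_def del: sym_group_inv_equality)
    have "?t \<circ> s = (?t \<circ> inv\<^bsub>?G\<^esub> p) \<circ> q" by (simp only: s_def sym_group_mult o_assoc)
    also have "\<dots> = ?t \<circ> (inv\<^bsub>?G\<^esub> q \<otimes>\<^bsub>?G\<^esub> q)" by (simp only: that(3) sym_group_mult o_assoc)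
    also have "\<dots> = ?t" using c by (simp add: sym_group_one del: sym_group_inv_equality)
    finally have "s \<in> ?Y" using s by (simp add: young_subgroup_stab)
    moreover have "q = p \<otimes>\<^bsub>?G\<^esub> s"
      using c by (simp add: s_def m_assoc[symmetric] del: sym_group_inv_equality)
    ultimately have q: "q \<in> p <#\<^bsub>?G\<^esub> ?Y" unfolding l_coset_def by blast
    then have "p \<in> q <#\<^bsub>?G\<^esub> ?Y" using coset[OF c(1) q] lcos_self[OF c(1)] by simp
    then have "perm_word ?N p = perm_word ?N q" using pq q rep by (metis lexordp_eq_antisym)
    then show ?thesis using c perm_word_inj by (auto simp: sym_group_carrier)
  qed
  have tw: "?t \<in> weight_configs r1 r2"
  proof -
    have "{i \<in> {1..?N}. ?t i = 1} = {1..r1}" "{i \<in> {1..?N}. ?t i = 2} = {r1+1..?N}"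
      by (auto simp: \<tau>0_def split: if_splits)
    then show ?thesis using tau0_config[of r1 r2] by (simp add: weight_configs_def)
  qed
  have into: "?t \<circ> inv\<^bsub>?G\<^esub> p \<in> weight_configs r1 r2" if p: "p \<in> carrier ?G" for p
  proof -
    have ip: "inv' p permutes {1..?N}" using p by (simp add: sym_group_carrier permutes_inv)
    have "card {i \<in> {1..?N}. ?t (inv' p i) = c} = card {i \<in> {1..?N}. ?t i = c}" for c
    proof (rule bij_betw_same_card[of "inv' p"])
      have "inv' p ` {i \<in> {1..?N}. ?t (inv' p i) = c} = {i \<in> {1..?N}. ?t i = c}"
        using permutes_in_image[OF ip] permutes_surj[OF ip] by (auto simp: image_iff simp del: atLeastAtMost_iff) (metis surjD)
      then show "bij_betw (inv' p) {i \<in> {1..?N}. ?t (inv' p i) = c} {i \<in> {1..?N}. ?t i = c}"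
        using permutes_inj[OF ip] by (auto simp: bij_betw_def intro: inj_on_subset)
    qed
    then show ?thesis using tw p spin_configs_comp[OF tau0_config p] by (simp add: weight_configs_def)
  qed
  have surj: "\<exists>p\<in>min_coset_reps r1 r2. \<sigma> = ?t \<circ> inv\<^bsub>?G\<^esub> p" if \<sigma>: "\<sigma> \<in> weight_configs r1 r2" for \<sigma>
  proof -
    have cnt: "count (image_mset f (mset_set {1..?N})) c = card {i \<in> {1..?N}. f i = c}" for f :: "nat \<Rightarrow> nat" and c
      by (auto simp: count_image_mset vimage_def intro!: arg_cong[of _ _ card])
    have vals: "{i \<in> {1..?N}. f i = c} = {}" if "f \<in> weight_configs r1 r2" "c \<noteq> 1" "c \<noteq> 2" for f c
      using that by (force simp: weight_configs_def spin_configs_def)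
    have "card {i \<in> {1..?N}. \<sigma> i = c} = card {i \<in> {1..?N}. ?t i = c}" for c
    proof (cases "c = 1 \<or> c = 2")
      case True then show ?thesis using \<sigma> tw unfolding weight_configs_def by auto
    next
      case False then show ?thesis using vals[OF \<sigma>, of c] vals[OF tw, of c] by presburger
    qed
    then have "image_mset ?t (mset_set {1..?N}) = image_mset \<sigma> (mset_set {1..?N})"
      by (intro multiset_eqI) (simp only: cnt)
    then obtain p where p: "p permutes {1..?N}" "\<forall>x\<in>{1..?N}. ?t x = \<sigma> (p x)"
      using image_mset_eq_implies_permutes[of "{1..?N}" ?t \<sigma>] by auto
    have "?t = \<sigma> \<circ> p"
    proof
      fix x show "?t x = (\<sigma> \<circ> p) x"
        using p permutes_not_in[OF p(1), of x] \<sigma>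
        by (cases "x \<in> {1..?N}") (auto simp: \<tau>0_def weight_configs_def spin_configs_def PiE_def extensional_def)
    qed
    then have s: "\<sigma> = ?t \<circ> inv' p" by (simp add: comp_assoc permutes_inv_o[OF p(1)])
    have pc: "p \<in> carrier ?G" using p by (simp add: sym_group_carrier)
    have "finite (p <#\<^bsub>?G\<^esub> ?Y)" using YG sym_group_finite[of ?N]
      by (auto simp: l_coset_def intro: finite_subset)
    moreover have "p <#\<^bsub>?G\<^esub> ?Y \<noteq> {}" using lcos_self[OF pc] by auto
    ultimately obtain m where m: "m \<in> p <#\<^bsub>?G\<^esub> ?Y"
      "\<forall>x\<in>p <#\<^bsub>?G\<^esub> ?Y. lexordp_eq (perm_word ?N m) (perm_word ?N x)" using lex_least by metis
    have mr: "m \<in> min_coset_reps r1 r2" using rep coset[OF pc m(1)] m(2) by simp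
    obtain y where y: "y \<in> ?Y" "m = p \<otimes>\<^bsub>?G\<^esub> y" using m(1) by (auto simp: l_coset_def)
    have "inv\<^bsub>?G\<^esub> y \<in> ?Y" using sub y(1) by (rule subgroup.m_inv_closed)
    then have "?t \<circ> inv\<^bsub>?G\<^esub> y = ?t" by (simp only: young_subgroup_stab mem_Collect_eq)
    moreover have "inv\<^bsub>?G\<^esub> m = inv\<^bsub>?G\<^esub> y \<circ> inv\<^bsub>?G\<^esub> p"
      using inv_mult_group[OF pc, of y] y YG by (auto simp only: sym_group_mult)
    ultimately have "?t \<circ> inv\<^bsub>?G\<^esub> m = ?t \<circ> inv\<^bsub>?G\<^esub> p" by (simp only: o_assoc)
    then have "\<sigma> = ?t \<circ> inv\<^bsub>?G\<^esub> m" by (simp only: s sym_group_inv_equality[OF pc])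
    then show ?thesis using mr by blast
  qed
  show ?thesis unfolding bij_betw_def
  proof (intro conjI inj_onI subset_antisym image_subsetI subsetI)
    show "?t \<circ> inv\<^bsub>?G\<^esub> p \<in> weight_configs r1 r2" if "p \<in> min_coset_reps r1 r2" for p
      using into rep that by blast
    show "\<sigma> \<in> (\<lambda>p. ?t \<circ> inv\<^bsub>?G\<^esub> p) ` min_coset_reps r1 r2" if "\<sigma> \<in> weight_configs r1 r2" for \<sigma>
      using surj[OF that] by blast
  qed (rule inj)
qed

lemma vec_coeff_ex1:
  assumes "v \<in> weight_space r1 r2"
  shows "\<exists>!a. a \<in> cfun.span (ket ` min_coset_reps r1 r2) \<and>
     v = act (r1 + r2) (a \<otimes>\<^bsub>sym_group_ring (r1 + r2)\<^esub> young_symmetrizer r1 r2) (ket (\<tau>0 r1 r2))"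
proof -
  let ?N = "r1 + r2" and ?t = "\<tau>0 r1 r2" and ?Y = "young_subgroup r1 r2"
  let ?G = "sym_group ?N" and ?R = "min_coset_reps r1 r2" and ?W = "weight_configs r1 r2"
  let ?f = "\<lambda>p. ?t \<circ> inv\<^bsub>?G\<^esub> p"
  note bij = reps_bij[of r1 r2]
  note sub = young_subgroup_subgroup[of r1 r2]
  interpret group ?G by (rule sym_group_is_group)
  have YG: "?Y \<subseteq> carrier ?G" using sub subgroup.subset by blast
  have finW: "finite ?W" using spin_configs_finite by (simp add: weight_configs_def)
  have RG: "?R \<subseteq> carrier ?G"
    using l_coset_carrier[OF _ _ sub] by (auto simp: min_coset_reps_def)
  then have finR: "finite ?R" using sym_group_finite finite_subset by blast
  have finY: "finite ?Y" using YG sym_group_finite finite_subset by blast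
  define c :: complex where "c = of_nat (card ?Y) / (fact r1 * fact r2)"
  have c: "c \<noteq> 0" using finY sub subgroup.one_closed[OF sub] by (auto simp: c_def)
  have symm: "act ?N (young_symmetrizer r1 r2) (ket ?t) = cscale c (ket ?t)"
  proof
    fix \<tau>
    have "act ?N (young_symmetrizer r1 r2) (ket ?t) \<tau>
      = (\<Sum>p\<in>carrier ?G. (if p \<in> ?Y then (1 / (fact r1 * fact r2)) * ket (?f p) \<tau> else 0))"
      unfolding act_ket[OF tau0_config]
      by (intro sum.cong refl) (use finY in \<open>simp add: young_symmetrizer_def cscale_apply sum_fun_apply ket_def sum.delta\<close>)
    also have "\<dots> = (\<Sum>p\<in>?Y. (1 / (fact r1 * fact r2)) * ket (?f p) \<tau>)"
      using YG by (subst sum.inter_restrict[symmetric, OF sym_group_finite]) (simp add: Int_absorb1)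
    also have "\<dots> = (\<Sum>p\<in>?Y. (1 / (fact r1 * fact r2)) * ket ?t \<tau>)"
    proof (intro sum.cong refl)
      fix p assume "p \<in> ?Y"
      then have "inv\<^bsub>?G\<^esub> p \<in> ?Y" using sub by (simp add: subgroup.m_inv_closed del: sym_group_inv_equality)
      then show "(1 / (fact r1 * fact r2)) * ket (?f p) \<tau> = (1 / (fact r1 * fact r2)) * ket ?t \<tau>"
        by (simp add: young_subgroup_stab del: sym_group_inv_equality)
    qed
    finally show "act ?N (young_symmetrizer r1 r2) (ket ?t) \<tau> = cscale c (ket ?t) \<tau>"
      by (simp add: c_def cscale_apply)
  qed
  have act_c: "act ?N a (cscale c u) = cscale c (act ?N a u)" for a u
    by (auto simp: fun_eq_iff act_apply cscale_apply sum_distrib_left algebra_simps intro!: sum.cong)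
  have key: "act ?N (a \<otimes>\<^bsub>sym_group_ring ?N\<^esub> young_symmetrizer r1 r2) (ket ?t) \<tau>
      = c * (\<Sum>p\<in>?R. a p * ket (?f p) \<tau>)" if "a \<in> cfun.span (ket ` ?R)" for a \<tau>
  proof -
    have "(\<Sum>p\<in>carrier ?G. a p * ket (?f p) \<tau>) = (\<Sum>p\<in>?R. a p * ket (?f p) \<tau>)"
      using that RG sym_group_finite by (intro sum.mono_neutral_right) (auto simp: in_span_ket[OF finR])
    then show ?thesis unfolding act_mult symm act_c by (simp add: cscale_apply act_ket[OF tau0_config])
  qed
  have at: "(\<Sum>p\<in>?R. a p * ket (?f p) (?f q)) = a q" if "q \<in> ?R" for a q
  proof -
    have "(\<Sum>p\<in>?R. a p * ket (?f p) (?f q)) = (\<Sum>p\<in>?R. if p = q then a p else 0)"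
      using that bij unfolding bij_betw_def inj_on_def
      by (intro sum.cong refl) (auto simp: ket_def simp del: sym_group_inv_equality)
    then show ?thesis using that finR by (simp add: sum.delta)
  qed
  have out: "(\<Sum>p\<in>?R. a p * ket (?f p) \<tau>) = 0" if "\<tau> \<notin> ?W" for a \<tau>
    using that bij unfolding bij_betw_def
    by (intro sum.neutral) (auto simp: ket_def simp del: sym_group_inv_equality)
  have v: "v \<tau> = 0" if "\<tau> \<notin> ?W" for \<tau>
    using assms that unfolding weight_space_def in_span_ket[OF finW] by auto
  have main: "v = act ?N (a \<otimes>\<^bsub>sym_group_ring ?N\<^esub> young_symmetrizer r1 r2) (ket ?t)
      \<longleftrightarrow> (\<forall>q\<in>?R. a q = v (?f q) / c)" if a: "a \<in> cfun.span (ket ` ?R)" for a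
  proof
    assume h: "v = act ?N (a \<otimes>\<^bsub>sym_group_ring ?N\<^esub> young_symmetrizer r1 r2) (ket ?t)"
    show "\<forall>q\<in>?R. a q = v (?f q) / c"
      using c unfolding h key[OF a] by (simp add: at del: sym_group_inv_equality)
  next
    assume h: "\<forall>q\<in>?R. a q = v (?f q) / c"
    show "v = act ?N (a \<otimes>\<^bsub>sym_group_ring ?N\<^esub> young_symmetrizer r1 r2) (ket ?t)"
    proof
      fix \<tau>
      show "v \<tau> = act ?N (a \<otimes>\<^bsub>sym_group_ring ?N\<^esub> young_symmetrizer r1 r2) (ket ?t) \<tau>"
      proof (cases "\<tau> \<in> ?W")
        case True
        then obtain q where q: "q \<in> ?R" "\<tau> = ?f q" using bij unfolding bij_betw_def by blast
        show ?thesis unfolding key[OF a] q(2) at[OF q(1)] using h q(1) c by simp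
      next
        case False then show ?thesis unfolding key[OF a] using out v by simp
      qed
    qed
  qed
  let ?a = "\<lambda>q. if q \<in> ?R then v (?f q) / c else 0"
  show ?thesis
  proof (rule ex1I[of _ ?a])
    have "?a \<in> cfun.span (ket ` ?R)" by (simp add: in_span_ket[OF finR])
    then show "?a \<in> cfun.span (ket ` ?R) \<and> v = act ?N (?a \<otimes>\<^bsub>sym_group_ring ?N\<^esub> young_symmetrizer r1 r2) (ket ?t)"
      using main by (simp del: sym_group_inv_equality)
  next
    fix a assume h: "a \<in> cfun.span (ket ` ?R) \<and> v = act ?N (a \<otimes>\<^bsub>sym_group_ring ?N\<^esub> young_symmetrizer r1 r2) (ket ?t)"
    then have "\<forall>q\<in>?R. a q = v (?f q) / c" using main by blast
    then show "a = ?a" using h by (auto simp: fun_eq_iff in_span_ket[OF finR])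
  qed
qed

end

theory Submission
  imports Defs
begin

text \<open>
  The idea is to describe the generator \<open>a\<^sub>v \<cdot> 1\<close> of the ideal of \<open>v\<close> without the coset
  representatives.  Pulling a vector \<open>u\<close> back along the orbit map \<open>p \<mapsto> p|\<tau>\<^sub>0\<rangle>\<close> of the group
  gives the group ring element \<open>\<Phi>(u) = \<Sum>\<^sub>p u(\<tau>\<^sub>0 \<circ> p\<^sup>-\<^sup>1) p\<close>.  The map \<open>\<Phi>\<close> is linear and commutes
  with left multiplication, \<open>\<Phi>(b u) = b \<Phi>(u)\<close> (\<open>orbit_pullback_act\<close>).  Since the Young subgroup
  \<open>Y\<close> is the stabilizer of \<open>|\<tau>\<^sub>0\<rangle>\<close>, the element \<open>\<Phi>(|\<tau>\<^sub>0\<rangle>)\<close> is the sum over \<open>Y\<close>, a multiple of the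
  symmetrizer \<open>1\<close>, while \<open>1|\<tau>\<^sub>0\<rangle>\<close> is a multiple of \<open>|\<tau>\<^sub>0\<rangle>\<close>.  Applying \<open>\<Phi>\<close> to
  \<open>v = a\<^sub>v \<cdot> 1|\<tau>\<^sub>0\<rangle>\<close> therefore yields \<open>a\<^sub>v \<cdot> 1 = \<Phi>(v) / |Y|\<close> for every \<open>v\<close> in the weight space
  (\<open>vec_coeff_symmetrizer\<close>).

  Both claims follow.  The ideal of \<open>v\<close> contains its generator, so the pullbacks of the basis vectors
  lie in \<open>\<R>\<^sub>U\<close>; by linearity so does \<open>\<Phi>(u)\<close> for every \<open>u \<in> U\<close>, and \<open>u = (\<Phi>(u) / |Y|)|\<tau>\<^sub>0\<rangle>\<close> is in
  the symmetry class of \<open>\<R>\<^sub>U\<close>.  Conversely, if \<open>v = b w\<close> with \<open>b\<close> in a right ideal \<open>\<R>\<close>, then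
  \<open>\<Phi>(v) = b \<Phi>(w) \<in> \<R>\<close>, whence \<open>\<R>\<close> contains the generator of the ideal of \<open>v\<close>.
\<close>

section \<open>Right ideals and sums of sets\<close>

lemma cscale_in_group_ring:
  assumes "x \<in> carrier (group_ring G)"
  shows "cscale c x \<in> carrier (group_ring G)"
  using assms by (simp add: group_ring_sel cfun.span_scale)

lemma group_ring_cscale_right:
  "a \<otimes>\<^bsub>group_ring G\<^esub> cscale c b = cscale c (a \<otimes>\<^bsub>group_ring G\<^esub> b)"
  by (auto simp: fun_eq_iff group_ring_mult_apply cscale_apply sum_distrib_left algebra_simps)

text \<open>Multiplication by a scalar is right multiplication by a multiple of the unit element.\<close>

lemma right_ideal_subspace:
  assumes G: "group G" "finite (carrier G)" and I: "right_ideal I (group_ring G)"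
  shows "cfun.subspace I"
proof -
  interpret ring "group_ring G" by (rule group_ring_ring[OF G])
  note I = I[unfolded right_ideal_iff[OF G]]
  show ?thesis
  proof (rule cfun.subspaceI)
    show "0 \<in> I" and "\<And>a b. a \<in> I \<Longrightarrow> b \<in> I \<Longrightarrow> a + b \<in> I" using I by auto
    show "cscale c a \<in> I" if a: "a \<in> I" for c a
    proof -
      have "a \<otimes>\<^bsub>group_ring G\<^esub> cscale c \<one>\<^bsub>group_ring G\<^esub> \<in> I"
        using I a cscale_in_group_ring[OF one_closed] by blast
      then show ?thesis using I a r_one[of a] by (auto simp: group_ring_cscale_right)
    qed
  qed
qed

lemma zero_in_sum_of_sets:
  fixes I :: "'i \<Rightarrow> 'a::comm_monoid_add set"
  assumes "\<And>k. k \<in> K \<Longrightarrow> 0 \<in> I k"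
  shows "0 \<in> (\<Sum>k\<in>K. I k)"
  using assms
proof (induction K rule: infinite_finite_induct)
  case (insert k K)
  then show ?case using set_plus_intro[of 0 "I k" 0 "\<Sum>k\<in>K. I k"] by simp
qed simp_all

lemma subset_sum_of_sets:
  fixes I :: "'i \<Rightarrow> 'a::comm_monoid_add set"
  assumes "finite K" "k \<in> K" "\<And>j. j \<in> K \<Longrightarrow> 0 \<in> I j"
  shows "I k \<subseteq> (\<Sum>j\<in>K. I j)"
proof
  fix x assume "x \<in> I k"
  then have "x + 0 \<in> I k + (\<Sum>j\<in>K - {k}. I j)"
    using assms(3) by (intro set_plus_intro zero_in_sum_of_sets) auto
  then show "x \<in> (\<Sum>j\<in>K. I j)" by (simp add: sum.remove[OF assms(1,2)])
qed

lemma sum_of_sets_subset: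
  assumes "\<And>k. k \<in> K \<Longrightarrow> I k \<subseteq> S" and S: "0 \<in> S" "\<And>a b. a \<in> S \<Longrightarrow> b \<in> S \<Longrightarrow> a + b \<in> S"
  shows "(\<Sum>k\<in>K. I k) \<subseteq> S"
  using assms(1)
proof (induction K rule: infinite_finite_induct)
  case (insert k K)
  show ?case
  proof
    fix x assume "x \<in> (\<Sum>j\<in>insert k K. I j)"
    then obtain a b where x: "x = a + b" "a \<in> I k" "b \<in> (\<Sum>j\<in>K. I j)"
      using insert.hyps by (auto elim: set_plus_elim)
    then have "a \<in> S" "b \<in> S" using insert.IH insert.prems by blast+
    then show "x \<in> S" using S(2) x(1) by blast
  qed
qed (use S(1) in auto)

section \<open>Pulling vectors back along the orbit map\<close>

text \<open>
  The transpose, in the bases of permutations and of symbols, of the linear map \<open>a \<mapsto> a|\<tau>\<^sub>0\<rangle>\<close> from the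
  group ring to the space of symbols.
\<close>

definition orbit_pullback ::
    "nat \<Rightarrow> nat \<Rightarrow> ((nat \<Rightarrow> nat) \<Rightarrow> complex) \<Rightarrow> (nat \<Rightarrow> nat) \<Rightarrow> complex" where
  "orbit_pullback r1 r2 u = (\<lambda>p. if p \<in> carrier (sym_group (r1 + r2))
     then u (\<tau>0 r1 r2 \<circ> inv\<^bsub>sym_group (r1 + r2)\<^esub> p) else 0)"

lemma orbit_pullback_in_group_ring: "orbit_pullback r1 r2 u \<in> carrier (sym_group_ring (r1 + r2))"
  by (simp add: group_ring_sel in_span_ket[OF sym_group_finite] orbit_pullback_def)

lemma orbit_pullback_add: "orbit_pullback r1 r2 (u + w) = orbit_pullback r1 r2 u + orbit_pullback r1 r2 w"
  by (auto simp: orbit_pullback_def)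

lemma orbit_pullback_cscale: "orbit_pullback r1 r2 (cscale c u) = cscale c (orbit_pullback r1 r2 u)"
  by (auto simp: orbit_pullback_def cscale_def)

lemma orbit_pullback_zero: "orbit_pullback r1 r2 0 = 0"
  by (auto simp: orbit_pullback_def)

text \<open>
  The orbit map is equivariant: both coefficients at \<open>q\<close> equal \<open>\<Sum>\<^sub>p b(p) u(\<tau>\<^sub>0 \<circ> q\<^sup>-\<^sup>1 \<circ> p)\<close>.
\<close>

lemma orbit_pullback_act:
  "orbit_pullback r1 r2 (act (r1 + r2) b u)
     = b \<otimes>\<^bsub>sym_group_ring (r1 + r2)\<^esub> orbit_pullback r1 r2 u"
proof
  let ?N = "r1 + r2" and ?t = "\<tau>0 r1 r2"
  let ?G = "sym_group ?N"
  let ?S = "carrier ?G" and ?C = "spin_configs ?N"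
  interpret group ?G by (rule sym_group_is_group)
  fix q
  show "orbit_pullback r1 r2 (act ?N b u) q = (b \<otimes>\<^bsub>sym_group_ring ?N\<^esub> orbit_pullback r1 r2 u) q"
  proof (cases "q \<in> ?S")
    case False
    then have "ket (p \<otimes>\<^bsub>?G\<^esub> r) q = 0" if "p \<in> ?S" "r \<in> ?S" for p r
      using that m_closed by (auto simp: ket_def)
    then show ?thesis using False by (simp add: orbit_pullback_def group_ring_mult_apply)
  next
    case q: True
    let ?\<rho> = "?t \<circ> inv\<^bsub>?G\<^esub> q"
    have act_term: "(\<Sum>\<sigma>\<in>?C. u \<sigma> * ket (\<sigma> \<circ> inv\<^bsub>?G\<^esub> p) ?\<rho>) = u (?\<rho> \<circ> p)" if p: "p \<in> ?S" for p
    proof -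
      have "inv\<^bsub>?G\<^esub> p \<circ> p = id" "p \<circ> inv\<^bsub>?G\<^esub> p = id"
        using l_inv[OF p] r_inv[OF p] by (simp_all only: sym_group_mult sym_group_one)
      then have "\<sigma> = (\<sigma> \<circ> inv\<^bsub>?G\<^esub> p) \<circ> p" "?\<rho> = (?\<rho> \<circ> p) \<circ> inv\<^bsub>?G\<^esub> p" for \<sigma>
        by (simp_all only: comp_assoc comp_id)
      then have iff: "?\<rho> = \<sigma> \<circ> inv\<^bsub>?G\<^esub> p \<longleftrightarrow> \<sigma> = ?\<rho> \<circ> p" for \<sigma>
        by metis
      have "?\<rho> \<circ> p = ?\<rho> \<circ> inv\<^bsub>?G\<^esub> (inv\<^bsub>?G\<^esub> p)" using p by (simp only: inv_inv)
      then have "?\<rho> \<circ> p \<in> ?C"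
        using p q by (simp only: spin_configs_comp tau0_config inv_closed)
      moreover have "(\<Sum>\<sigma>\<in>?C. u \<sigma> * ket (\<sigma> \<circ> inv\<^bsub>?G\<^esub> p) ?\<rho>) = (\<Sum>\<sigma>\<in>?C. if \<sigma> = ?\<rho> \<circ> p then u \<sigma> else 0)"
        by (intro sum.cong refl) (simp only: ket_def iff, simp)
      ultimately show ?thesis by (simp only: sum.delta[OF spin_configs_finite] if_True)
    qed
    have ring_term: "(\<Sum>r\<in>?S. orbit_pullback r1 r2 u r * ket (p \<otimes>\<^bsub>?G\<^esub> r) q) = u (?\<rho> \<circ> p)"
      if p: "p \<in> ?S" for p
    proof -
      let ?r = "inv\<^bsub>?G\<^esub> p \<otimes>\<^bsub>?G\<^esub> q"
      have r: "?r \<in> ?S" using p q by (simp only: m_closed inv_closed)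
      have iff: "q = p \<otimes>\<^bsub>?G\<^esub> r \<longleftrightarrow> r = ?r" if "r \<in> ?S" for r
        using inv_solve_left[OF that p q] by simp
      have "(\<Sum>r\<in>?S. orbit_pullback r1 r2 u r * ket (p \<otimes>\<^bsub>?G\<^esub> r) q)
          = (\<Sum>r\<in>?S. if r = ?r then orbit_pullback r1 r2 u r else 0)"
        by (intro sum.cong refl) (simp only: ket_def iff, simp)
      also have "\<dots> = orbit_pullback r1 r2 u ?r"
        using r by (simp only: sum.delta[OF sym_group_finite] if_True)
      also have "\<dots> = u (?t \<circ> inv\<^bsub>?G\<^esub> ?r)" using r by (simp only: orbit_pullback_def if_True)
      also have "inv\<^bsub>?G\<^esub> ?r = inv\<^bsub>?G\<^esub> q \<circ> p"
        using p q by (simp only: inv_mult_group inv_closed inv_inv) (simp only: sym_group_mult)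
      also have "?t \<circ> (inv\<^bsub>?G\<^esub> q \<circ> p) = ?\<rho> \<circ> p" by (rule o_assoc)
      finally show ?thesis .
    qed
    have "act ?N b u ?\<rho> = (\<Sum>p\<in>?S. b p * u (?\<rho> \<circ> p))"
      unfolding act_apply mult.assoc sum_distrib_left[symmetric]
      by (intro sum.cong refl) (simp only: act_term)
    moreover have "(b \<otimes>\<^bsub>sym_group_ring ?N\<^esub> orbit_pullback r1 r2 u) q = (\<Sum>p\<in>?S. b p * u (?\<rho> \<circ> p))"
      unfolding group_ring_mult_apply mult.assoc sum_distrib_left[symmetric]
      by (intro sum.cong refl) (simp only: ring_term)
    ultimately show ?thesis using q by (simp only: orbit_pullback_def if_True)
  qed
qed

lemma finite_young_subgroup: "finite (young_subgroup r1 r2)"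
  using sym_group_finite by (rule finite_subset[rotated]) (auto simp: young_subgroup_def)

lemma card_young_subgroup_nonzero: "card (young_subgroup r1 r2) \<noteq> 0"
  using finite_young_subgroup[of r1 r2] subgroup.one_closed[OF young_subgroup_subgroup[of r1 r2]]
  by (auto simp only: card_eq_0_iff)

lemma young_symmetrizer_apply:
  "young_symmetrizer r1 r2 p = (if p \<in> young_subgroup r1 r2 then 1 / (fact r1 * fact r2) else 0)"
  by (simp add: young_symmetrizer_def cscale_apply sum_fun_apply ket_def finite_young_subgroup)

lemma tau0_young_inv:
  assumes "p \<in> carrier (sym_group (r1 + r2))"
  shows "\<tau>0 r1 r2 \<circ> inv\<^bsub>sym_group (r1 + r2)\<^esub> p = \<tau>0 r1 r2 \<longleftrightarrow> p \<in> young_subgroup r1 r2"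
proof -
  let ?G = "sym_group (r1 + r2)"
  interpret group ?G by (rule sym_group_is_group)
  have "p \<in> young_subgroup r1 r2 \<longleftrightarrow> inv\<^bsub>?G\<^esub> p \<in> young_subgroup r1 r2"
    using subgroup.m_inv_closed[OF young_subgroup_subgroup] inv_inv[OF assms] by metis
  then show ?thesis using inv_closed[OF assms] unfolding young_subgroup_stab by blast
qed

lemma act_young_symmetrizer_tau0:
  "act (r1 + r2) (young_symmetrizer r1 r2) (ket (\<tau>0 r1 r2))
     = cscale (of_nat (card (young_subgroup r1 r2)) / (fact r1 * fact r2)) (ket (\<tau>0 r1 r2))"
proof
  let ?G = "sym_group (r1 + r2)" and ?Y = "young_subgroup r1 r2" and ?t = "\<tau>0 r1 r2"
  fix \<tau>
  have Y: "?Y \<subseteq> carrier ?G" by (auto simp: young_subgroup_def)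
  have "act (r1 + r2) (young_symmetrizer r1 r2) (ket ?t) \<tau>
      = (\<Sum>p\<in>carrier ?G. if p \<in> ?Y then 1 / (fact r1 * fact r2) * ket ?t \<tau> else 0)"
    unfolding act_ket[OF tau0_config]
    by (intro sum.cong refl)
      (simp add: young_symmetrizer_apply tau0_young_inv[THEN iffD2] del: sym_group_inv_equality)
  also have "\<dots> = (\<Sum>p\<in>?Y. 1 / (fact r1 * fact r2) * ket ?t \<tau>)"
    using Y by (simp add: sum.inter_restrict[symmetric, OF sym_group_finite] Int_absorb1)
  finally show "act (r1 + r2) (young_symmetrizer r1 r2) (ket ?t) \<tau>
      = cscale (of_nat (card ?Y) / (fact r1 * fact r2)) (ket ?t) \<tau>"
    by (simp add: cscale_apply)
qed

text \<open>The coefficient at \<open>p\<close> tells whether \<open>p\<close> fixes \<open>|\<tau>\<^sub>0\<rangle>\<close>, and the stabilizer is the Young subgroup.\<close>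

lemma orbit_pullback_tau0:
  "orbit_pullback r1 r2 (ket (\<tau>0 r1 r2)) = cscale (fact r1 * fact r2) (young_symmetrizer r1 r2)"
proof
  fix p
  show "orbit_pullback r1 r2 (ket (\<tau>0 r1 r2)) p
      = cscale (fact r1 * fact r2) (young_symmetrizer r1 r2) p"
    using subgroup.subset[OF young_subgroup_subgroup[of r1 r2]]
    by (auto simp: orbit_pullback_def ket_def tau0_young_inv cscale_apply young_symmetrizer_apply
        simp del: sym_group_inv_equality)
qed

section \<open>The ideal of a vector\<close>

lemma act_cscale: "act N a (cscale c u) = cscale c (act N a u)"
  by (auto simp: fun_eq_iff act_apply cscale_apply sum_distrib_left algebra_simps)

lemma vec_coeff_act:
  assumes "v \<in> weight_space r1 r2"
  shows "act (r1 + r2) (vec_coeff r1 r2 v \<otimes>\<^bsub>sym_group_ring (r1 + r2)\<^esub> young_symmetrizer r1 r2)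
    (ket (\<tau>0 r1 r2)) = v"
  using theI'[OF vec_coeff_ex1[OF assms]] unfolding vec_coeff_def by simp

text \<open>
  Pull back \<open>v = a\<^sub>v \<cdot> 1|\<tau>\<^sub>0\<rangle>\<close>.  The product \<open>r\<^sub>1! r\<^sub>2!\<close> cancels: it divides the multiple of \<open>|\<tau>\<^sub>0\<rangle>\<close>
  that \<open>1|\<tau>\<^sub>0\<rangle>\<close> is, and multiplies the pullback of \<open>|\<tau>\<^sub>0\<rangle>\<close>.  The formula shows that the generator of
  the ideal of \<open>v\<close> is linear in \<open>v\<close> and inherits every left factor of \<open>v\<close>.
\<close>

lemma vec_coeff_symmetrizer:
  assumes "v \<in> weight_space r1 r2"
  shows "vec_coeff r1 r2 v \<otimes>\<^bsub>sym_group_ring (r1 + r2)\<^esub> young_symmetrizer r1 r2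
    = cscale (1 / of_nat (card (young_subgroup r1 r2))) (orbit_pullback r1 r2 v)"
proof -
  let ?R = "sym_group_ring (r1 + r2)" and ?t = "ket (\<tau>0 r1 r2)"
  let ?a = "vec_coeff r1 r2 v" and ?e = "young_symmetrizer r1 r2"
  let ?n = "of_nat (card (young_subgroup r1 r2)) :: complex"
  have "v = act (r1 + r2) ?a (act (r1 + r2) ?e ?t)"
    using vec_coeff_act[OF assms] by (simp add: act_mult)
  also have "\<dots> = cscale (?n / (fact r1 * fact r2)) (act (r1 + r2) ?a ?t)"
    by (simp add: act_young_symmetrizer_tau0 act_cscale)
  finally have "orbit_pullback r1 r2 v
      = cscale (?n / (fact r1 * fact r2)) (?a \<otimes>\<^bsub>?R\<^esub> cscale (fact r1 * fact r2) ?e)"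
    by (metis orbit_pullback_cscale orbit_pullback_act orbit_pullback_tau0)
  also have "\<dots> = cscale ?n (?a \<otimes>\<^bsub>?R\<^esub> ?e)"
    by (simp add: group_ring_cscale_right)
  finally show ?thesis
    using card_young_subgroup_nonzero[of r1 r2] by simp
qed

lemma vec_coeff_symmetrizer_in_vec_ideal:
  "vec_coeff r1 r2 v \<otimes>\<^bsub>sym_group_ring (r1 + r2)\<^esub> young_symmetrizer r1 r2 \<in> vec_ideal r1 r2 v"
proof -
  let ?R = "sym_group_ring (r1 + r2)"
  interpret ring ?R by (rule group_ring_ring[OF sym_group_is_group sym_group_finite])
  have "vec_coeff r1 r2 v \<otimes>\<^bsub>?R\<^esub> young_symmetrizer r1 r2 \<in> carrier ?R"
    by (rule group_ring_closed[OF sym_group_is_group])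
  note r_one[OF this, symmetric]
  then show ?thesis unfolding vec_ideal_def using one_closed by blast
qed

text \<open>
  If \<open>v = b w\<close> with \<open>b\<close> in the right ideal, then the generator of the ideal of \<open>v\<close> is a multiple of
  \<open>b \<Phi>(w)\<close>.
\<close>

lemma vec_ideal_least:
  assumes v: "v \<in> weight_space r1 r2" "v \<in> symmetry_class (r1 + r2) R"
    and R: "right_ideal R (sym_group_ring (r1 + r2))"
  shows "vec_ideal r1 r2 v \<subseteq> R"
proof -
  note G = sym_group_is_group[of "r1 + r2"] sym_group_finite[of "r1 + r2"]
  note RI = R[unfolded right_ideal_iff[OF G]]
  obtain b w where b: "b \<in> R" "v = act (r1 + r2) b w"
    using v(2) by (auto simp: symmetry_class_def)
  have "orbit_pullback r1 r2 v \<in> R"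
    using RI b orbit_pullback_in_group_ring by (simp add: orbit_pullback_act)
  then have "vec_coeff r1 r2 v \<otimes>\<^bsub>sym_group_ring (r1 + r2)\<^esub> young_symmetrizer r1 r2 \<in> R"
    unfolding vec_coeff_symmetrizer[OF v(1)]
    by (rule cfun.subspace_scale[OF right_ideal_subspace[OF G R]])
  then show ?thesis using RI by (auto simp: vec_ideal_def)
qed

section \<open>The smallest right ideal whose symmetry class contains a subspace\<close>

theorem theorem2p11:
  fixes N r1 r2 l :: nat
    and U :: "((nat \<Rightarrow> nat) \<Rightarrow> complex) set"
    and v :: "nat \<Rightarrow> (nat \<Rightarrow> nat) \<Rightarrow> complex"
    and R_U :: "((nat \<Rightarrow> nat) \<Rightarrow> complex) set"
  assumes "N = r1 + r2"
    and "cfun.subspace U"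
    and "U \<subseteq> weight_space r1 r2"
    and "inj_on v {1..l}"
    and "cfun.independent (v ` {1..l})"
    and "cfun.span (v ` {1..l}) = U"
    and "R_U = (\<Sum>k\<in>{1..l}. vec_ideal r1 r2 (v k))"
  shows "U \<subseteq> symmetry_class N R_U \<and>
    (\<forall>R. right_ideal R (sym_group_ring N) \<longrightarrow> U \<subseteq> symmetry_class N R \<longrightarrow> R_U \<subseteq> R)"
proof (intro conjI allI impI)
  note G = sym_group_is_group[of "r1 + r2"] sym_group_finite[of "r1 + r2"]
  let ?n = "of_nat (card (young_subgroup r1 r2)) :: complex"
  have vU: "v k \<in> U" if "k \<in> {1..l}" for k
    using that assms(6) cfun.span_base by blast
  have "right_ideal R_U (sym_group_ring (r1 + r2))"
    unfolding assms(7) by (intro right_ideal_sum[OF G] vec_ideal_right_ideal) simp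
  then have sub: "cfun.subspace R_U" by (rule right_ideal_subspace[OF G])
  show "U \<subseteq> symmetry_class N R_U"
  proof
    fix u assume u: "u \<in> U"
    then have uW: "u \<in> weight_space r1 r2" using assms(3) by blast
    \<comment> \<open>Membership of the generator in \<open>\<R>\<^sub>U\<close> is a linear condition, so it passes from the basis to \<open>U\<close>.\<close>
    have "cfun.subspace {u. cscale (1 / ?n) (orbit_pullback r1 r2 u) \<in> R_U}"
    proof (rule cfun.subspaceI; clarify)
      fix c x assume "cscale (1 / ?n) (orbit_pullback r1 r2 x) \<in> R_U"
      then show "cscale (1 / ?n) (orbit_pullback r1 r2 (cscale c x)) \<in> R_U"
        unfolding orbit_pullback_cscale cfun.scale_left_commute[of _ c]
        by (rule cfun.subspace_scale[OF sub])
    qed (use cfun.subspace_0[OF sub] cfun.subspace_add[OF sub] in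
      \<open>simp_all add: orbit_pullback_zero orbit_pullback_add cfun.scale_right_distrib\<close>)
    moreover have "cscale (1 / ?n) (orbit_pullback r1 r2 (v k)) \<in> R_U" if k: "k \<in> {1..l}" for k
    proof -
      have "0 \<in> vec_ideal r1 r2 (v j)" for j
        using vec_ideal_right_ideal right_ideal_iff[OF G] by blast
      then have "vec_ideal r1 r2 (v k) \<subseteq> R_U"
        unfolding assms(7) by (intro subset_sum_of_sets k) simp_all
      moreover have "v k \<in> weight_space r1 r2" using vU[OF k] assms(3) by blast
      ultimately show ?thesis
        using vec_coeff_symmetrizer_in_vec_ideal[of r1 r2 "v k"]
        by (simp only: vec_coeff_symmetrizer) blast
    qed
    ultimately have "cscale (1 / ?n) (orbit_pullback r1 r2 u) \<in> R_U"
      using cfun.span_induct[of u "v ` {1..l}" "\<lambda>u. cscale (1 / ?n) (orbit_pullback r1 r2 u) \<in> R_U"]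
        u assms(6) by blast
    moreover have "act N (cscale (1 / ?n) (orbit_pullback r1 r2 u)) (ket (\<tau>0 r1 r2)) = u"
      using vec_coeff_act[OF uW] by (simp only: vec_coeff_symmetrizer[OF uW] assms(1))
    moreover have "ket (\<tau>0 r1 r2) \<in> spin_space N"
      unfolding spin_space_def assms(1) by (intro cfun.span_base imageI tau0_config)
    ultimately show "u \<in> symmetry_class N R_U" unfolding symmetry_class_def by force
  qed
  fix R assume R: "right_ideal R (sym_group_ring N)" "U \<subseteq> symmetry_class N R"
  then have "vec_ideal r1 r2 (v k) \<subseteq> R" if "k \<in> {1..l}" for k
    using vec_ideal_least vU[OF that] assms(1,3) by blast
  moreover have "cfun.subspace R" using right_ideal_subspace[OF G] R(1) assms(1) by blast
  ultimately show "R_U \<subseteq> R"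
    unfolding assms(7) by (intro sum_of_sets_subset cfun.subspace_0 cfun.subspace_add)
qed

end
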